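(* Let the functions $f(x)$ and $g(x)$ satisfy the growth condition: $|f(x)|\leq Kx^{m\operatorname{Re}\rho}e^{x/\beta}$ and $|g(x)|\leq Kx^{m\operatorname{Re}\rho}e^{x/\beta}$ for all $x>T$, where $K,T,\beta$ are positive constants. If $F(u,v,\omega)=\mathcal M_{\rho,m}[f(x)](u,v,\omega)$ and $G(u,v,\omega)=\mathcal M_{\rho,m}[g(x)](u,v,\omega)$ are the $\mathcal M_{\rho,m}$-images of $f$ and $g$, respectively, then $$F(u,v,\omega)\,G(u,v,\omega)=\mathcal M_{\rho,m}\big[(f*_{\mathcal M}g)(x)\big](u,v,\omega),$$ where $$(f*_{\mathcal M}g)(x)=\Big[\Big(\frac x\omega\Big)^m+\omega^m\Big]^{\rho}e^{v\omega/x}\int_0^{x/\omega}\frac{f(x-\omega t)\,e^{-\frac{v\omega}{x-\omega t}}}{\big[\big(\frac1\omega(x-\omega t)\big)^m+\omega^m\big]^{\rho}}\;\frac{g(\omega t)\,e^{-v/t}}{(t^m+\omega^m)^{\rho}}\,dt.$$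
   Context: Here $\rho\in\mathbb C$ with $\operatorname{Re}\rho>0$, $m\in\mathbb N=\{1,2,\dots\}$, and $u,v\in\mathbb C$, $\omega\in\mathbb R^+$ (positive reals) are the variables of the transform $$\mathcal M_{\rho,m}[f(x)](u,v,\omega)=\int_0^\infty \frac{e^{-ux-v/x}}{(x^m+\omega^m)^\rho}f(\omega x)\,dx,$$ where $x$ inside the brackets is a dummy variable. The convolution $f*_{\mathcal M}g$ depends on the parameters $\rho,m,v,\omega$, which are the same as those of the transform. *)

theory Defs
  imports "HOL-Analysis.Analysis"
begin

text \<open>
  Powers with the complex exponent \<open>\<rho>\<close> are principal powers; their base is a positive real.
  All integrals are Lebesgue integrals, so a transform exists at a point iff its integral
  converges absolutely there.
\<close>

definition M_integrand ::
    "complex \<Rightarrow> nat \<Rightarrow> (real \<Rightarrow> complex) \<Rightarrow> complex \<Rightarrow> complex \<Rightarrow> real \<Rightarrow> real \<Rightarrow> complex" where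
  "M_integrand \<rho> m f u v \<omega> x =
     exp (- u * of_real x - v / of_real x) / (of_real (x ^ m + \<omega> ^ m) powr \<rho>) * f (\<omega> * x)"

definition M_exists ::
    "complex \<Rightarrow> nat \<Rightarrow> (real \<Rightarrow> complex) \<Rightarrow> complex \<Rightarrow> complex \<Rightarrow> real \<Rightarrow> bool" where
  "M_exists \<rho> m f u v \<omega> \<longleftrightarrow> set_integrable lebesgue {0<..} (M_integrand \<rho> m f u v \<omega>)"

definition M_transform ::
    "complex \<Rightarrow> nat \<Rightarrow> (real \<Rightarrow> complex) \<Rightarrow> complex \<Rightarrow> complex \<Rightarrow> real \<Rightarrow> complex" where
  "M_transform \<rho> m f u v \<omega> = (LINT x:{0<..}|lebesgue. M_integrand \<rho> m f u v \<omega> x)"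

text \<open>
  Only the values at \<open>x > 0\<close> matter. For integrands that are merely Lebesgue integrable the inner
  integral converges for almost every \<open>x\<close>; the library value \<open>0\<close> on the exceptional null set does
  not affect the transform.
\<close>

definition M_conv ::
    "complex \<Rightarrow> nat \<Rightarrow> complex \<Rightarrow> real \<Rightarrow> (real \<Rightarrow> complex) \<Rightarrow> (real \<Rightarrow> complex) \<Rightarrow> real \<Rightarrow> complex" where
  "M_conv \<rho> m v \<omega> f g x =
     of_real ((x / \<omega>) ^ m + \<omega> ^ m) powr \<rho> * exp (v * of_real \<omega> / of_real x) *
     (LINT t:{0<..<x / \<omega>}|lebesgue.
        f (x - \<omega> * t) * exp (- (v * of_real \<omega> / of_real (x - \<omega> * t)))
          / (of_real ((1 / \<omega> * (x - \<omega> * t)) ^ m + \<omega> ^ m) powr \<rho>)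
        * (g (\<omega> * t) * exp (- (v / of_real t)) / (of_real (t ^ m + \<omega> ^ m) powr \<rho>)))"

definition M_growth ::
    "complex \<Rightarrow> nat \<Rightarrow> real \<Rightarrow> real \<Rightarrow> real \<Rightarrow> (real \<Rightarrow> complex) \<Rightarrow> bool" where
  "M_growth \<rho> m K T \<beta> f \<longleftrightarrow>
     (\<forall>x>T. norm (f x) \<le> K * x powr (real m * Re \<rho>) * exp (x / \<beta>))"

text \<open>
  The growth condition controls the integral at infinity: together with integrability on the
  bounded intervals \<open>(0, a]\<close> it makes the transform exist for \<open>Re u > \<omega> / \<beta>\<close>.
\<close>

lemma M_exists_if_growth:
  assumes "Re \<rho> > 0" and "K > 0" "T > 0" "\<beta> > 0" "\<omega> > 0"
    and growth: "M_growth \<rho> m K T \<beta> f"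
    and loc: "\<And>a. a > 0 \<Longrightarrow> set_integrable lebesgue {0<..a} (M_integrand \<rho> m f u v \<omega>)"
    and u: "Re u > \<omega> / \<beta>"
  shows "M_exists \<rho> m f u v \<omega>"
proof -
  let ?h = "M_integrand \<rho> m f u v \<omega>"
  define a where "a = T / \<omega>"
  define c where "c = Re u - \<omega> / \<beta>"
  define C where "C = K * exp (norm v / a) * \<omega> powr (real m * Re \<rho>)"
  have a: "a > 0" and c: "c > 0"
    using assms by (auto simp: a_def c_def)
  have "(\<lambda>x. indicator {0<..} x *\<^sub>R ?h x) \<in> borel_measurable lebesgue"
  proof (rule borel_measurable_LIMSEQ_metric)
    show "(\<lambda>x. indicator {0<..real n + 1} x *\<^sub>R ?h x) \<in> borel_measurable lebesgue" for n
      using loc[of "real n + 1"] by (auto simp: set_integrable_def)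
    show "(\<lambda>n. indicator {0<..real n + 1} x *\<^sub>R ?h x) \<longlonglongrightarrow> indicator {0<..} x *\<^sub>R ?h x" for x :: real
    proof (rule tendsto_eventually)
      have "\<forall>\<^sub>F n in sequentially. x \<le> real n + 1"
        by (rule eventually_sequentiallyI[of "nat \<lceil>x\<rceil>"]) linarith
      then show "\<forall>\<^sub>F n in sequentially.
          indicator {0<..real n + 1} x *\<^sub>R ?h x = indicator {0<..} x *\<^sub>R ?h x"
        by eventually_elim (auto simp: indicator_def)
    qed
  qed
  then have "?h \<in> borel_measurable (lebesgue_on {0<..})"
    by (subst borel_measurable_restrict_space_iff) auto
  then have "?h \<in> borel_measurable (lebesgue_on {a<..})"
    by (rule measurable_restrict_mono) (use a in auto)
  moreover have "(\<lambda>x. C * exp (- c * x)) integrable_on {a<..}"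
  proof -
    have "(\<lambda>x. C * exp (- c * x)) integrable_on {a..}"
      using integrable_on_exp_minus_to_infinity[OF c, of a] by (rule integrable_on_mult_right)
    then show ?thesis
      by (rule integrable_spike_set) (auto intro: negligible_subset[OF negligible_sing[of a]])
  qed
  moreover have "norm (?h x) \<le> C * exp (- c * x)" if x: "x \<in> {a<..}" for x
  proof -
    have xa: "x > a" and x0: "x > 0"
      using x a by auto
    have "\<omega> * x > T"
      using xa \<open>\<omega> > 0\<close> by (simp add: a_def field_simps)
    have f: "norm (f (\<omega> * x)) \<le>
        K * (\<omega> powr (real m * Re \<rho>) * x powr (real m * Re \<rho>)) * exp (\<omega> * x / \<beta>)"
      using growth \<open>\<omega> * x > T\<close> x0 \<open>\<omega> > 0\<close> by (auto simp: M_growth_def powr_mult)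
    have "- Re (v / of_real x) \<le> norm v / x"
      using complex_Re_le_cmod[of "- (v / of_real x)"] x0 by (simp add: norm_divide)
    also have "\<dots> \<le> norm v / a"
      using xa a by (intro divide_left_mono) auto
    finally have e: "norm (exp (- u * of_real x - v / of_real x)) \<le> exp (- (Re u * x)) * exp (norm v / a)"
      by (simp add: norm_exp_eq_Re exp_add[symmetric])
    have p: "x powr (real m * Re \<rho>) \<le> (x ^ m + \<omega> ^ m) powr Re \<rho>"
    proof -
      have "x powr (real m * Re \<rho>) = (x ^ m) powr Re \<rho>"
        using x0 by (simp add: powr_powr[symmetric] powr_realpow)
      also have "\<dots> \<le> (x ^ m + \<omega> ^ m) powr Re \<rho>"
        using x0 \<open>\<omega> > 0\<close> \<open>Re \<rho> > 0\<close> by (intro powr_mono2) auto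
      finally show ?thesis .
    qed
    have pos: "x ^ m + \<omega> ^ m > 0"
      using x0 \<open>\<omega> > 0\<close> by (simp add: add_pos_pos)
    have "norm (?h x) = norm (exp (- u * of_real x - v / of_real x)) / (x ^ m + \<omega> ^ m) powr Re \<rho>
        * norm (f (\<omega> * x))"
      using pos by (simp add: M_integrand_def norm_mult norm_divide norm_powr_real_powr del: of_real_add of_real_power)
    also have "\<dots> \<le> (exp (- (Re u * x)) * exp (norm v / a)) / x powr (real m * Re \<rho>)
        * (K * (\<omega> powr (real m * Re \<rho>) * x powr (real m * Re \<rho>)) * exp (\<omega> * x / \<beta>))"
      using e p f x0 by (intro mult_mono frac_le) auto
    also have "\<dots> = C * exp (- c * x)"
      using x0 by (simp add: C_def c_def field_simps exp_add exp_diff exp_minus)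
    finally show ?thesis .
  qed
  ultimately have "set_integrable lebesgue {a<..} ?h"
    by (intro measurable_bounded_by_integrable_imp_absolutely_integrable) auto
  then have "set_integrable lebesgue ({0<..a} \<union> {a<..}) ?h"
    using loc[OF a] by (intro set_integrable_Un) auto
  moreover have "{0<..a} \<union> {a<..} = {0<..}"
    using a by auto
  ultimately show ?thesis
    by (simp add: M_exists_def)
qed

end

theory Submission
  imports Defs
begin

text \<open>
  Up to the factor \<open>e\<^sup>-\<^sup>u\<^sup>x\<close> the prefactor of \<open>f *\<^sub>\<M> g\<close> cancels the kernel of the transform, so the
  transform integrand of \<open>f *\<^sub>\<M> g\<close> is the ordinary convolution of the transform integrands of
  \<open>f\<close> and \<open>g\<close>, extended by zero to the left half-line. The claim is therefore Fubini's theorem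
  for the convolution of two integrable functions on the line.
\<close>

text \<open>The preimages of a measurable set under \<open>f\<close> and \<open>g\<close> differ
  only inside a null set, and completeness makes every such modification measurable. The condition
  on \<open>g\<close> covers the exceptional points, where almost everywhere equality gives no
  control.\<close>

lemma (in complete_measure) measurable_cong_AE_imp:
  assumes f: "f \<in> measurable M N" and AE: "AE x in M. f x = g x"
    and g: "g \<in> space M \<rightarrow> space N"
  shows "g \<in> measurable M N"
proof (rule measurableI)
  show "g x \<in> space N" if "x \<in> space M" for x
    using g that by auto
  fix A assume A: "A \<in> sets N"
  show "g -` A \<inter> space M \<in> sets M"
  proof (rule in_sets_AE)
    show "AE x in M. (x \<in> f -` A \<inter> space M) = (x \<in> g -` A \<inter> space M)"
      using AE by eventually_elim auto
    show "f -` A \<inter> space M \<in> sets M"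
      using f A by (rule measurable_sets)
  qed auto
qed

text \<open>The real-valued case applies to each coordinate. \<open>Basis\<close> is finite, so the
  exceptional sets have a null union, off which the coordinates reassemble to
  \<open>g\<close>.\<close>

lemma completion_ex_borel_measurable_euclidean:
  fixes g :: "'a \<Rightarrow> 'b::euclidean_space"
  assumes g: "g \<in> borel_measurable (completion M)"
  shows "\<exists>g'\<in>borel_measurable M. (AE x in M. g x = g' x)"
proof -
  have "\<forall>i\<in>Basis. \<exists>h\<in>borel_measurable M. (AE x in M. g x \<bullet> i = h x)"
    using g by (intro ballI completion_ex_borel_measurable_real) auto
  then obtain h where h: "\<And>i. i \<in> Basis \<Longrightarrow> h i \<in> borel_measurable M"
    and AE: "\<And>i. i \<in> Basis \<Longrightarrow> AE x in M. g x \<bullet> i = h i x"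
    unfolding Ball_def Bex_def by metis
  have "AE x in M. \<forall>i\<in>Basis. g x \<bullet> i = h i x"
    using AE by (intro AE_finite_allI) auto
  then have "AE x in M. g x = (\<Sum>i\<in>Basis. h i x *\<^sub>R i)"
  proof eventually_elim
    case (elim x)
    then have "(\<Sum>i\<in>Basis. h i x *\<^sub>R i) = (\<Sum>i\<in>Basis. (g x \<bullet> i) *\<^sub>R i)"
      by simp
    then show ?case
      by (simp add: euclidean_representation)
  qed
  moreover have "(\<lambda>x. \<Sum>i\<in>Basis. h i x *\<^sub>R i) \<in> borel_measurable M"
    using h by auto
  ultimately show ?thesis
    by (rule bexI)
qed

lemma lborel_distr_reflect: "distr lborel borel (\<lambda>x. c - x) = (lborel :: 'a::euclidean_space measure)"
  using lborel_affine[of "-1" c] by (simp add: density_1)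

text \<open>A reflection preserves Lebesgue measure, so null sets pull back to null sets. This lets
  \<open>f\<close> be replaced by an almost everywhere equal function inside
  \<open>f (x - t)\<close> for each fixed \<open>x\<close>.\<close>

lemma AE_lborel_reflect:
  fixes P :: "'a::euclidean_space \<Rightarrow> bool"
  assumes "AE x in lborel. P x"
  shows "AE x in lborel. P (c - x)"
proof -
  have "AE x in distr lborel borel (\<lambda>x. c - x). P x"
    using assms unfolding lborel_distr_reflect .
  then show ?thesis
    by (rule AE_distrD[rotated]) simp
qed

lemma lborel_integrable_translation:
  fixes f :: "'a::euclidean_space \<Rightarrow> 'b::{banach, second_countable_topology}"
  assumes "integrable lborel f"
  shows "integrable lborel (\<lambda>x. f (x - t))"
proof -
  have [measurable]: "f \<in> borel_measurable borel"
    using assms by (simp add: integrable_iff_bounded)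
  have "integrable (distr lborel borel ((+) (-t))) f"
    using assms by (simp add: lborel_distr_plus)
  then show ?thesis
    by (subst (asm) integrable_distr_eq) auto
qed

lemma lborel_integral_translation:
  fixes f :: "'a::euclidean_space \<Rightarrow> 'b::{banach, second_countable_topology}"
  assumes [measurable]: "f \<in> borel_measurable borel"
  shows "(LINT x|lborel. f (x - t)) = (LINT x|lborel. f x)"
proof -
  have "(LINT x|lborel. f x) = (LINT x|distr lborel borel ((+) (-t)). f x)"
    by (simp add: lborel_distr_plus)
  also have "\<dots> = (LINT x|lborel. f (x - t))"
    by (subst integral_distr) auto
  finally show ?thesis ..
qed

text \<open>By translation invariance the double integral of the norms is the product of the two L1
  norms, so Fubini's theorem applies; the same computation without norms gives the value. Borel
  measurability of \<open>f\<close> yields joint measurability of \<open>f (x - t)\<close>.\<close>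

lemma lborel_convolution:
  fixes f g :: "'a::euclidean_space \<Rightarrow> 'b::{real_normed_field, banach, second_countable_topology}"
  assumes f: "integrable lborel f" and g: "integrable lborel g"
  shows "integrable lborel (\<lambda>x. LINT t|lborel. f (x - t) * g t)" (is ?int)
    and "(LINT x|lborel. LINT t|lborel. f (x - t) * g t) = (LINT x|lborel. f x) * (LINT x|lborel. g x)"
      (is ?eq)
proof -
  have [measurable]: "f \<in> borel_measurable borel" "g \<in> borel_measurable borel"
    using f g by (auto simp: integrable_iff_bounded)
  \<comment> \<open>The order \<open>(t, x)\<close> puts the integral over \<open>x\<close>
    innermost, where the shift by \<open>t\<close> disappears.\<close>
  have *: "integrable (lborel \<Otimes>\<^sub>M lborel) (\<lambda>(t, x). f (x - t) * g t)"
  proof (rule lborel_pair.Fubini_integrable)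
    have "(LINT x|lborel. norm (f (x - t) * g t)) = (LINT x|lborel. norm (f x)) * norm (g t)" for t
      by (simp add: norm_mult lborel_integral_translation[of "\<lambda>x. norm (f x)"])
    then show "integrable lborel (\<lambda>t. LINT x|lborel. norm (case (t, x) of (t, x) \<Rightarrow> f (x - t) * g t))"
      using g by (simp only: prod.case) simp
    show "AE t in lborel. integrable lborel (\<lambda>x. case (t, x) of (t, x) \<Rightarrow> f (x - t) * g t)"
      unfolding prod.case
      by (intro AE_I2 integrable_mult_left lborel_integrable_translation f)
  qed measurable
  show ?int
    using lborel_pair.integrable_snd[OF *] .
  show ?eq
    by (subst lborel_pair.Fubini_integral[OF *]) (simp add: lborel_integral_translation[of f])
qed

text \<open>Joint measurability of \<open>f (x - t)\<close> is not immediate for Lebesgue measurable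
  \<open>f\<close>, so both functions are replaced by Borel representatives, to which the Borel case
  applies.\<close>

lemma lebesgue_integrable_convolution:
  fixes f g :: "'a::euclidean_space \<Rightarrow> 'b::{euclidean_space, real_normed_field}"
  assumes f: "integrable lebesgue f" and g: "integrable lebesgue g"
  shows "integrable lebesgue (\<lambda>x. LINT t|lebesgue. f (x - t) * g t)" (is ?int)
    and "(LINT x|lebesgue. LINT t|lebesgue. f (x - t) * g t) =
      (LINT x|lebesgue. f x) * (LINT x|lebesgue. g x)" (is ?eq)
proof -
  have borel_version: "\<exists>h'\<in>borel_measurable borel. (AE x in lborel. h x = h' x) \<and>
      integrable lborel h' \<and> (LINT x|lebesgue. h x) = (LINT x|lborel. h' x)"
    if h: "integrable lebesgue h" for h :: "'a \<Rightarrow> 'b"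
  proof -
    obtain h' where h': "h' \<in> borel_measurable lborel" and AE: "AE x in lborel. h x = h' x"
      using completion_ex_borel_measurable_euclidean[of h lborel] borel_measurable_integrable[OF h]
      by blast
    have AE': "AE x in lebesgue. h x = h' x"
      using AE by (rule AE_completion)
    have m: "h' \<in> borel_measurable lebesgue"
      using h' by (rule measurable_completion)
    have "integrable lebesgue h'"
      using h m AE' by (rule integrable_cong_AE_imp)
    moreover have "(LINT x|lebesgue. h x) = (LINT x|lebesgue. h' x)"
      using h m AE' by (intro integral_cong_AE) auto
    ultimately show ?thesis
      using h' AE by (intro bexI[of _ h']) (simp_all add: integrable_completion integral_completion)
  qed
  obtain f' where f'[measurable]: "f' \<in> borel_measurable borel" and AE_f: "AE x in lborel. f x = f' x"
    and int_f': "integrable lborel f'" and eq_f: "(LINT x|lebesgue. f x) = (LINT x|lborel. f' x)"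
    using borel_version[OF f] by blast
  obtain g' where g'[measurable]: "g' \<in> borel_measurable borel" and AE_g: "AE x in lborel. g x = g' x"
    and int_g': "integrable lborel g'" and eq_g: "(LINT x|lebesgue. g x) = (LINT x|lborel. g' x)"
    using borel_version[OF g] by blast
  \<comment> \<open>This holds at every \<open>x\<close>, not just almost every one; where the
    integrals diverge, both have the default value 0.\<close>
  have conv: "(LINT t|lebesgue. f (x - t) * g t) = (LINT t|lborel. f' (x - t) * g' t)" for x
  proof -
    have "AE t in lborel. f' (x - t) * g' t = f (x - t) * g t"
      using AE_lborel_reflect[OF AE_f, of x] AE_g by eventually_elim simp
    then have AE: "AE t in lebesgue. f' (x - t) * g' t = f (x - t) * g t"
      by (rule AE_completion)
    have m: "(\<lambda>t. f' (x - t) * g' t) \<in> borel_measurable lborel"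
      by simp
    have m': "(\<lambda>t. f' (x - t) * g' t) \<in> borel_measurable lebesgue"
      using m by (rule measurable_completion)
    \<comment> \<open>Equality of the integrals asks for measurability of both integrands;
      completeness passes it from the Borel product to the original one.\<close>
    then have "(\<lambda>t. f (x - t) * g t) \<in> borel_measurable lebesgue"
      using AE by (rule completion.measurable_cong_AE_imp) auto
    then have "(LINT t|lebesgue. f (x - t) * g t) = (LINT t|lebesgue. f' (x - t) * g' t)"
      using AE m' by (intro integral_cong_AE) auto
    then show ?thesis
      using m by (simp add: integral_completion)
  qed
  note int = lborel_convolution[OF int_f' int_g']
  have m: "(\<lambda>x. LINT t|lborel. f' (x - t) * g' t) \<in> borel_measurable lborel"
    using int(1) by (rule borel_measurable_integrable)
  show ?int
    unfolding conv integrable_completion[OF m] by (rule int(1))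
  show ?eq
    unfolding conv integral_completion[OF m] eq_f eq_g by (rule int(2))
qed

text \<open>Extension by zero reduces this to the whole line: the product of the extensions at
  \<open>x - t\<close> and \<open>t\<close> vanishes unless \<open>0 < t\<close> and
  \<open>t < x\<close>.\<close>

lemma set_convolution_half_line:
  fixes f g :: "real \<Rightarrow> 'b::{euclidean_space, real_normed_field}"
  assumes f: "set_integrable lebesgue {0<..} f" and g: "set_integrable lebesgue {0<..} g"
  shows "set_integrable lebesgue {0<..} (\<lambda>x. LINT t:{0<..<x}|lebesgue. f (x - t) * g t)" (is ?int)
    and "(LINT x:{0<..}|lebesgue. LINT t:{0<..<x}|lebesgue. f (x - t) * g t) =
      (LINT x:{0<..}|lebesgue. f x) * (LINT x:{0<..}|lebesgue. g x)" (is ?eq)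
proof -
  let ?f = "\<lambda>x. indicator {0<..} x *\<^sub>R f x" and ?g = "\<lambda>x. indicator {0<..} x *\<^sub>R g x"
  \<comment> \<open>For \<open>x \<le> 0\<close> the interval is empty, so the indicator of
    \<open>x\<close> may stand in front; it supplies the form of the outer set integral.\<close>
  have "?f (x - t) * ?g t = indicator {0<..} x *\<^sub>R indicator {0<..<x} t *\<^sub>R (f (x - t) * g t)" for x t
    by (simp add: indicator_def)
  then have conv: "indicator {0<..} x *\<^sub>R (LINT t:{0<..<x}|lebesgue. f (x - t) * g t) =
      (LINT t|lebesgue. ?f (x - t) * ?g t)" for x
    by (simp only: set_lebesgue_integral_def integral_scaleR_right)
  note * = lebesgue_integrable_convolution[of ?f ?g, folded set_integrable_def, OF f g]
  show ?int
    using *(1) by (simp only: set_integrable_def conv)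
  show ?eq
    using *(2) by (simp only: set_lebesgue_integral_def[where A = "{0<..}"] conv)
qed

text \<open>The transform evaluates the convolution at \<open>\<omega> * x\<close>, where the upper
  limit becomes \<open>x\<close> and the prefactor cancels the kernel down to
  \<open>exp (- u * x)\<close>. This exponential then splits between \<open>x - t\<close> and
  \<open>t\<close>.\<close>

lemma M_integrand_M_conv:
  assumes \<omega>: "\<omega> > 0" and x: "x > 0"
  shows "M_integrand \<rho> m (M_conv \<rho> m v \<omega> f g) u v \<omega> x =
    (LINT t:{0<..<x}|lebesgue. M_integrand \<rho> m f u v \<omega> (x - t) * M_integrand \<rho> m g u v \<omega> t)"
proof -
  let ?p = "of_real (x ^ m + \<omega> ^ m) powr \<rho>"
  let ?I = "\<lambda>t. f (\<omega> * x - \<omega> * t) * exp (- (v * of_real \<omega> / of_real (\<omega> * x - \<omega> * t)))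
      / (of_real ((1 / \<omega> * (\<omega> * x - \<omega> * t)) ^ m + \<omega> ^ m) powr \<rho>)
      * (g (\<omega> * t) * exp (- (v / of_real t)) / (of_real (t ^ m + \<omega> ^ m) powr \<rho>))"
  have "x ^ m + \<omega> ^ m > 0"
    using \<omega> x by (simp add: add_pos_pos)
  then have p: "?p \<noteq> 0"
    by (metis less_irrefl of_real_eq_0_iff powr_eq_0_iff)
  \<comment> \<open>Used with \<open>y = x\<close> in the prefactor and with
    \<open>y = x - t\<close> under the integral.\<close>
  have e: "v * of_real \<omega> / of_real (\<omega> * y) = v / of_real y" for y
    using \<omega> by simp
  have "M_integrand \<rho> m (M_conv \<rho> m v \<omega> f g) u v \<omega> x =
      exp (- u * of_real x - v / of_real x) / ?p *
      (?p * exp (v / of_real x) * (LINT t:{0<..<x}|lebesgue. ?I t))"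
    using \<omega> unfolding M_integrand_def M_conv_def e by simp
  also have "\<dots> = exp (- u * of_real x) * (LINT t:{0<..<x}|lebesgue. ?I t)"
    using p by (simp add: exp_diff)
  \<comment> \<open>No convergence is required here: the factor is nonzero, so a divergent integral
    is 0 on both sides.\<close>
  also have "\<dots> = (LINT t:{0<..<x}|lebesgue. exp (- u * of_real x) * ?I t)"
    by (rule set_integral_mult_right[symmetric])
  also have "\<dots> = (LINT t:{0<..<x}|lebesgue.
      M_integrand \<rho> m f u v \<omega> (x - t) * M_integrand \<rho> m g u v \<omega> t)"
  proof (rule set_lebesgue_integral_cong)
    show "\<forall>t. t \<in> {0<..<x} \<longrightarrow> exp (- u * of_real x) * ?I t =
        M_integrand \<rho> m f u v \<omega> (x - t) * M_integrand \<rho> m g u v \<omega> t"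
    proof (intro allI impI)
      fix t
      have s: "\<omega> * x - \<omega> * t = \<omega> * (x - t)" "1 / \<omega> * (\<omega> * (x - t)) = x - t"
        using \<omega> by (auto simp: algebra_simps)
      have "exp (- u * of_real x) = exp (- u * of_real (x - t)) * exp (- u * of_real t)"
        by (simp add: exp_add[symmetric] algebra_simps)
      then show "exp (- u * of_real x) * ?I t =
          M_integrand \<rho> m f u v \<omega> (x - t) * M_integrand \<rho> m g u v \<omega> t"
        \<comment> \<open>The pattern \<open>- u * _\<close> confines the rewriting of differences
          to the exponents of the two kernels and leaves \<open>x - t\<close> intact.\<close>
        unfolding s e M_integrand_def diff_conv_add_uminus[of "- u * _"] exp_add by simp
    qed
  qed auto
  finally show ?thesis .
qed

theorem theorem3p4:
  fixes \<rho> :: complex and m :: nat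
    and f g :: "real \<Rightarrow> complex"
    and F G :: "complex \<Rightarrow> complex \<Rightarrow> real \<Rightarrow> complex"
    and u v :: complex and \<omega> K T \<beta> :: real
  assumes "Re \<rho> > 0" and "m \<ge> 1" and "\<omega> > 0"
    and "K > 0" and "T > 0" and "\<beta> > 0"
    and "M_growth \<rho> m K T \<beta> f" and "M_growth \<rho> m K T \<beta> g"
    and "F = M_transform \<rho> m f" and "G = M_transform \<rho> m g"
    and "M_exists \<rho> m f u v \<omega>" and "M_exists \<rho> m g u v \<omega>"
  shows "M_exists \<rho> m (M_conv \<rho> m v \<omega> f g) u v \<omega> \<and>
         F u v \<omega> * G u v \<omega> = M_transform \<rho> m (M_conv \<rho> m v \<omega> f g) u v \<omega>"
proof -
  let ?f = "M_integrand \<rho> m f u v \<omega>" and ?g = "M_integrand \<rho> m g u v \<omega>"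
  \<comment> \<open>The indicators extend the pointwise identity to the whole line, so that it can
    be rewritten under the integral and inside the integrability claim.\<close>
  have eq: "indicator {0<..} x *\<^sub>R M_integrand \<rho> m (M_conv \<rho> m v \<omega> f g) u v \<omega> x =
      indicator {0<..} x *\<^sub>R (LINT t:{0<..<x}|lebesgue. ?f (x - t) * ?g t)" for x :: real
    using \<open>\<omega> > 0\<close> by (cases "x > 0") (simp_all add: M_integrand_M_conv)
  have "set_integrable lebesgue {0<..} ?f" "set_integrable lebesgue {0<..} ?g"
    using assms by (auto simp: M_exists_def)
  note * = set_convolution_half_line[OF this]
  have "M_exists \<rho> m (M_conv \<rho> m v \<omega> f g) u v \<omega>"
    using *(1) by (simp only: M_exists_def set_integrable_def eq)
  moreover have "M_transform \<rho> m (M_conv \<rho> m v \<omega> f g) u v \<omega> = F u v \<omega> * G u v \<omega>"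
    using *(2) unfolding assms(9,10) M_transform_def
    by (simp only: set_lebesgue_integral_def[where A = "{0<..}"] eq)
  ultimately show ?thesis by simp
qed

end
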